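(* Let $r$ be an odd prime and $n\ge1$. Then the numbers $N_{\zeta^s}(n)$, $1\le s<r$, are all equal, and the numbers $N_{-\zeta^s}(n)$, $1\le s<r$, are all equal.
   Context: $G(n,r)=\mathbb{Z}_r^n\rtimes S_n$, where $\mathbb{Z}_r=\mathbb{Z}/r\mathbb{Z}$ and $S_n$ permutes coordinates; $G(0,r)$ is trivial. $P(n,r)$ is the set of $r$-tuples $\lambda=(\lambda_1,\dots,\lambda_r)$ of partitions (possibly empty) with $\sum_k|\lambda_k|=n$. Fix a primitive $r$-th root of unity $\zeta$; also write $\zeta$ for the character $\zeta(x;w)=\zeta^{x_1+\dots+x_n}$ of $G(n,r)$ and $\mathrm{sgn}(x;w)$ for the sign of $w$. For a partition $\mu$ of $m$, let $\rho_\mu$ be the corresponding irreducible complex representation of $S_m$ and $\rho_\mu^k(x;w)=\zeta^{k(x_1+\dots+x_m)}\rho_\mu(w)$ its extension to $G(m,r)$. With $a_k=|\lambda_k|$, the irreducible representation of $G(n,r)$ indexed by $\lambda$ is $$\rho_\lambda=\mathrm{Ind}_{G(a_1,r)\times\dots\times G(a_r,r)}^{G(n,r)}\ \rho_{\lambda_1}^{0}\boxtimes\rho_{\lambda_2}^{1}\boxtimes\dots\boxtimes\rho_{\lambda_r}^{r-1}.$$ $N_{\zeta^s}(n)$ (resp. $N_{-\zeta^s}(n)$) is the number of $\lambda\in P(n,r)$ such that the character $\det\rho_\lambda$ equals $\zeta^s$ (resp. $\zeta^s\cdot\mathrm{sgn}$); for $n=1$, where $\mathrm{sgn}$ is trivial,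 $N_{-\zeta^s}(1)=0$. *)

theory Defs
  imports
    "HOL-Library.Function_Algebras"
    "HOL-Algebra.Sym_Groups"
    "HOL-Algebra.Product_Groups"
    "HOL-Computational_Algebra.Primes"
    "Jordan_Normal_Form.Determinant"
begin

section \<open>Determinants of operators on finite-dimensional function spaces\<close>

text \<open>
  All representation spaces below are complex subspaces of function spaces \<open>'x \<Rightarrow> complex\<close>.
\<close>

definition fscale :: "complex \<Rightarrow> ('x \<Rightarrow> complex) \<Rightarrow> 'x \<Rightarrow> complex" where
  "fscale c f = (\<lambda>x. c * f x)"

global_interpretation cfun: vector_space "fscale :: complex \<Rightarrow> ('x \<Rightarrow> complex) \<Rightarrow> 'x \<Rightarrow> complex"
  by unfold_locales (simp_all add: fscale_def fun_eq_iff algebra_simps)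

text \<open>
  \<open>ordered_basis V bs\<close>: \<open>bs\<close> is a finite ordered basis of \<open>V\<close>. The determinant of an
  endomorphism of \<open>V\<close> is that of its matrix in an arbitrary ordered basis.
\<close>

definition ordered_basis :: "('x \<Rightarrow> complex) set \<Rightarrow> ('x \<Rightarrow> complex) list \<Rightarrow> bool" where
  "ordered_basis V bs \<longleftrightarrow>
     distinct bs \<and> cfun.independent (set bs) \<and> cfun.span (set bs) = V"

definition op_matrix ::
  "('x \<Rightarrow> complex) list \<Rightarrow> (('x \<Rightarrow> complex) \<Rightarrow> 'x \<Rightarrow> complex) \<Rightarrow> complex mat" where
  "op_matrix bs T =
     mat (length bs) (length bs) (\<lambda>(i, j). cfun.representation (set bs) (T (bs ! j)) (bs ! i))"

definition op_det ::
  "('x \<Rightarrow> complex) set \<Rightarrow> (('x \<Rightarrow> complex) \<Rightarrow> 'x \<Rightarrow> complex) \<Rightarrow> complex" where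
  "op_det V T = det (op_matrix (SOME bs. ordered_basis V bs) T)"


section \<open>Complex representations\<close>

text \<open>
  A representation consists of a space \<open>V\<close> of functions and operators preserving \<open>V\<close>. The
  operators are given on all functions, but only their restriction to \<open>V\<close> is relevant.
\<close>

record ('g, 'x) crep =
  rep_space :: "('x \<Rightarrow> complex) set"
  rep_act :: "'g \<Rightarrow> ('x \<Rightarrow> complex) \<Rightarrow> 'x \<Rightarrow> complex"

definition rep_det :: "('g, 'x) crep \<Rightarrow> 'g \<Rightarrow> complex" where
  "rep_det \<rho> g = op_det (rep_space \<rho>) (rep_act \<rho> g)"

text \<open>
  External tensor product \<open>\<rho> 0 \<boxtimes> \<dots> \<boxtimes> \<rho> (r - 1)\<close>: the tensor product of the
  function spaces is realised inside the functions of \<open>r\<close> variables, with \<open>f\<^sub>0 \<otimes> \<dots> \<otimes> f\<^sub>r\<^sub>-\<^sub>1\<close>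
  being the function \<open>X \<mapsto> \<Prod>k<r. f k (X k)\<close>. The operator \<open>T\<^sub>0 \<otimes> \<dots> \<otimes> T\<^sub>r\<^sub>-\<^sub>1\<close> applies each
  \<open>T\<^sub>k\<close> with respect to the \<open>k\<close>-th variable.
\<close>

definition pure_tensor :: "nat \<Rightarrow> (nat \<Rightarrow> 'x \<Rightarrow> complex) \<Rightarrow> (nat \<Rightarrow> 'x) \<Rightarrow> complex" where
  "pure_tensor r f = (\<lambda>X. \<Prod>k<r. f k (X k))"

definition apply_slot ::
  "nat \<Rightarrow> (('x \<Rightarrow> complex) \<Rightarrow> 'x \<Rightarrow> complex) \<Rightarrow> ((nat \<Rightarrow> 'x) \<Rightarrow> complex) \<Rightarrow> (nat \<Rightarrow> 'x) \<Rightarrow> complex" where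
  "apply_slot k T F = (\<lambda>X. T (\<lambda>y. F (X(k := y))) (X k))"

definition ext_tensor ::
  "nat \<Rightarrow> (nat \<Rightarrow> ('g, 'x) crep) \<Rightarrow> (nat \<Rightarrow> 'g, nat \<Rightarrow> 'x) crep" where
  "ext_tensor r \<rho> =
     \<lparr> rep_space = cfun.span {pure_tensor r f | f. \<forall>k<r. f k \<in> rep_space (\<rho> k)},
       rep_act = (\<lambda>g. fold (\<lambda>k. apply_slot k (rep_act (\<rho> k) (g k))) [0..<r]) \<rparr>"

definition pullback_rep :: "('h \<Rightarrow> 'g) \<Rightarrow> ('g, 'x) crep \<Rightarrow> ('h, 'x) crep" where
  "pullback_rep \<phi> \<rho> = \<lparr> rep_space = rep_space \<rho>, rep_act = (\<lambda>h. rep_act \<rho> (\<phi> h)) \<rparr>"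

text \<open>
  Induction from a subgroup \<open>H\<close> of \<open>G\<close>: the functions \<open>F\<close> from \<open>G\<close> to the space of \<open>\<sigma>\<close> (in
  uncurried form, extended by zero outside \<open>G\<close>) with \<open>F (h g) = \<sigma> h (F g)\<close> for \<open>h \<in> H\<close>, on
  which \<open>G\<close> acts by right translation.
\<close>

definition induced_rep ::
  "('g, 'm) monoid_scheme \<Rightarrow> 'g set \<Rightarrow> ('g, 'x) crep \<Rightarrow> ('g, 'g \<times> 'x) crep" where
  "induced_rep G H \<sigma> =
     \<lparr> rep_space = {F. (\<forall>g y. g \<notin> carrier G \<longrightarrow> F (g, y) = 0) \<and>
         (\<forall>g\<in>carrier G. (\<lambda>y. F (g, y)) \<in> rep_space \<sigma>) \<and>
         (\<forall>h\<in>H. \<forall>g\<in>carrier G.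
            (\<lambda>y. F (h \<otimes>\<^bsub>G\<^esub> g, y)) = rep_act \<sigma> h (\<lambda>y. F (g, y)))},
       rep_act = (\<lambda>g F (g', y). if g' \<in> carrier G then F (g' \<otimes>\<^bsub>G\<^esub> g, y) else 0) \<rparr>"


section \<open>Partitions and the irreducible representations of the symmetric groups\<close>

definition is_partition :: "nat list \<Rightarrow> bool" where
  "is_partition \<mu> \<longleftrightarrow> sorted_wrt (\<ge>) \<mu> \<and> 0 \<notin> set \<mu>"

text \<open>
  The cell (row, column), counted from 0, of the entry \<open>i \<in> {1..sum_list \<mu>}\<close> in the tableau of
  shape \<open>\<mu>\<close> filled with \<open>1, 2, \<dots>\<close> row by row.
\<close>

fun tableau_cell :: "nat list \<Rightarrow> nat \<Rightarrow> nat \<times> nat" where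
  "tableau_cell [] i = (0, 0)"
| "tableau_cell (a # \<mu>) i =
     (if i \<le> a then (0, i - 1)
      else (let (p, q) = tableau_cell \<mu> (i - a) in (Suc p, q)))"

definition row_group :: "nat list \<Rightarrow> (nat \<Rightarrow> nat) set" where
  "row_group \<mu> = {p. p permutes {1..sum_list \<mu>} \<and>
     (\<forall>i\<in>{1..sum_list \<mu>}. fst (tableau_cell \<mu> (p i)) = fst (tableau_cell \<mu> i))}"

definition col_group :: "nat list \<Rightarrow> (nat \<Rightarrow> nat) set" where
  "col_group \<mu> = {q. q permutes {1..sum_list \<mu>} \<and>
     (\<forall>i\<in>{1..sum_list \<mu>}. snd (tableau_cell \<mu> (q i)) = snd (tableau_cell \<mu> i))}"

text \<open>
  Elements of the group algebra of \<open>S\<^sub>m\<close> are identified with functions on permutations. The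
  irreducible representation \<open>\<rho>\<^sub>\<mu>\<close> is the left ideal generated by the Young symmetrizer
  \<open>(\<Sum>p. p) (\<Sum>q. sgn q q)\<close>, with \<open>p\<close> and \<open>q\<close> ranging over the row and the column group.
\<close>

definition young_symmetrizer :: "nat list \<Rightarrow> (nat \<Rightarrow> nat) \<Rightarrow> complex" where
  "young_symmetrizer \<mu> =
     (\<lambda>w. \<Sum>p\<in>row_group \<mu>. \<Sum>q\<in>col_group \<mu>. if w = p \<circ> q then of_int (sign q) else 0)"

definition left_mult :: "(nat \<Rightarrow> nat) \<Rightarrow> ((nat \<Rightarrow> nat) \<Rightarrow> complex) \<Rightarrow> (nat \<Rightarrow> nat) \<Rightarrow> complex" where
  "left_mult w f = (\<lambda>v. f (Hilbert_Choice.inv w \<circ> v))"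

definition specht_rep :: "nat list \<Rightarrow> (nat \<Rightarrow> nat, nat \<Rightarrow> nat) crep" where
  "specht_rep \<mu> =
     \<lparr> rep_space =
         cfun.span ((\<lambda>w. left_mult w (young_symmetrizer \<mu>)) ` carrier (sym_group (sum_list \<mu>))),
       rep_act = left_mult \<rparr>"


section \<open>The groups \<open>G(n,r)\<close> and their irreducible representations\<close>

text \<open>
  The semidirect product of \<open>\<int>\<^sub>r\<^sup>n\<close> and \<open>S\<^sub>n\<close>, where \<open>(w y)\<^sub>i = y\<^bsub>w\<inverse>(i)\<^esub>\<close>.
\<close>

type_synonym gelem = "(nat \<Rightarrow> int) \<times> (nat \<Rightarrow> nat)"

definition gen_sym_group :: "nat \<Rightarrow> nat \<Rightarrow> gelem monoid" where
  "gen_sym_group n r =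
     (let Z = product_group {1..n} (\<lambda>_. integer_mod_group r) in
      \<lparr> carrier = carrier Z \<times> carrier (sym_group n),
        monoid.mult = (\<lambda>(x, w) (y, v).
          (x \<otimes>\<^bsub>Z\<^esub> (\<lambda>i\<in>{1..n}. y (Hilbert_Choice.inv w i)), w \<otimes>\<^bsub>sym_group n\<^esub> v)),
        one = (\<one>\<^bsub>Z\<^esub>, \<one>\<^bsub>sym_group n\<^esub>) \<rparr>)"

definition primitive_root_of_unity :: "nat \<Rightarrow> complex \<Rightarrow> bool" where
  "primitive_root_of_unity r \<zeta> \<longleftrightarrow> r > 0 \<and> \<zeta> ^ r = 1 \<and> (\<forall>k. 0 < k \<and> k < r \<longrightarrow> \<zeta> ^ k \<noteq> 1)"

definition zeta_char :: "complex \<Rightarrow> nat \<Rightarrow> gelem \<Rightarrow> complex" where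
  "zeta_char \<zeta> n = (\<lambda>(x, w). \<zeta> powi (\<Sum>i\<in>{1..n}. x i))"

definition sgn_char :: "gelem \<Rightarrow> complex" where
  "sgn_char = (\<lambda>(x, w). of_int (sign w))"

definition ext_specht_rep :: "complex \<Rightarrow> nat \<Rightarrow> nat list \<Rightarrow> (gelem, nat \<Rightarrow> nat) crep" where
  "ext_specht_rep \<zeta> k \<mu> =
     \<lparr> rep_space = rep_space (specht_rep \<mu>),
       rep_act = (\<lambda>g f. fscale (zeta_char \<zeta> (sum_list \<mu>) g ^ k) (rep_act (specht_rep \<mu>) (snd g) f)) \<rparr>"

text \<open>
  For a list \<open>a = [a\<^sub>0, \<dots>, a\<^sub>r\<^sub>-\<^sub>1]\<close> with sum \<open>n\<close>, the group \<open>G(a\<^sub>0,r) \<times> \<dots> \<times> G(a\<^sub>r\<^sub>-\<^sub>1,r)\<close> is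
  embedded in \<open>G(n,r)\<close> as the elements whose permutation preserves the consecutive blocks of
  lengths \<open>a\<^sub>k\<close>; \<open>block_proj\<close> gives the components of such an element.
\<close>

definition block_start :: "nat list \<Rightarrow> nat \<Rightarrow> nat" where
  "block_start a k = sum_list (take k a)"

definition block_subgroup :: "nat \<Rightarrow> nat list \<Rightarrow> gelem set" where
  "block_subgroup r a =
     {(x, w) \<in> carrier (gen_sym_group (sum_list a) r). \<forall>k<length a.
        w ` {block_start a k <.. block_start a (Suc k)} = {block_start a k <.. block_start a (Suc k)}}"

definition block_proj :: "nat list \<Rightarrow> gelem \<Rightarrow> nat \<Rightarrow> gelem" where
  "block_proj a = (\<lambda>(x, w) k.
     ((\<lambda>i\<in>{1..a ! k}. x (block_start a k + i)),
      (\<lambda>i. if i \<in> {1..a ! k} then w (block_start a k + i) - block_start a k else i)))"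

text \<open>
  The \<open>r\<close>-tuples are indexed from 0, so the component \<open>lam ! k\<close> goes with the exponent \<open>k\<close>.
\<close>

definition multipartitions :: "nat \<Rightarrow> nat \<Rightarrow> nat list list set" where
  "multipartitions n r =
     {lam. length lam = r \<and> (\<forall>\<mu>\<in>set lam. is_partition \<mu>) \<and> (\<Sum>\<mu>\<leftarrow>lam. sum_list \<mu>) = n}"

definition irrep ::
  "complex \<Rightarrow> nat \<Rightarrow> nat list list \<Rightarrow> (gelem, gelem \<times> (nat \<Rightarrow> nat \<Rightarrow> nat)) crep" where
  "irrep \<zeta> r lam =
     (let a = map sum_list lam in
      induced_rep (gen_sym_group (sum_list a) r) (block_subgroup r a)
        (pullback_rep (block_proj a) (ext_tensor r (\<lambda>k. ext_specht_rep \<zeta> k (lam ! k)))))"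

text \<open>
  For \<open>n = 1\<close> the character \<open>sgn\<close> is trivial; \<open>N_minus\<close> is 0 then by convention, so that
  no tuple is counted twice.
\<close>

definition N_plus :: "complex \<Rightarrow> nat \<Rightarrow> nat \<Rightarrow> nat \<Rightarrow> nat" where
  "N_plus \<zeta> r s n = card {lam \<in> multipartitions n r.
     \<forall>g\<in>carrier (gen_sym_group n r). rep_det (irrep \<zeta> r lam) g = zeta_char \<zeta> n g ^ s}"

definition N_minus :: "complex \<Rightarrow> nat \<Rightarrow> nat \<Rightarrow> nat \<Rightarrow> nat" where
  "N_minus \<zeta> r s n = (if n = 1 then 0 else card {lam \<in> multipartitions n r.
     \<forall>g\<in>carrier (gen_sym_group n r).
       rep_det (irrep \<zeta> r lam) g = zeta_char \<zeta> n g ^ s * sgn_char g})"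

end

theory Submission
  imports Defs "HOL-Number_Theory.Cong"
begin

text \<open>
  For \<open>u\<close> prime to \<open>r\<close> the map \<open>(x, w) \<mapsto> (u x, w)\<close> is an automorphism of \<open>G(n,r)\<close>. Twisting
  \<open>\<rho>\<^sub>\<lambda>\<close> by it turns the factor with exponent \<open>k\<close> into one with exponent \<open>u k\<close>, so the twist is
  isomorphic to \<open>\<rho>\<close> of the tuple in which the components of \<open>\<lambda>\<close> are permuted by multiplication
  by \<open>u\<close> modulo \<open>r\<close>. On determinants the twist sends \<open>\<zeta>\<^sup>s\<close> to \<open>\<zeta>\<^sup>u\<^sup>s\<close> and fixes \<open>sgn\<close>, and
  multiplication by units is transitive on the nonzero residues modulo the prime \<open>r\<close>.
\<close>

section \<open>Determinants and changes of basis\<close>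

text \<open>The version of \<open>op_matrix\<close> with two bases, since the intertwiner maps
  between different spaces. For \<open>cs = bs\<close> it is \<open>op_matrix bs\<close>.\<close>

definition map_matrix ::
  "('x \<Rightarrow> complex) list \<Rightarrow> ('y \<Rightarrow> complex) list \<Rightarrow> (('x \<Rightarrow> complex) \<Rightarrow> 'y \<Rightarrow> complex) \<Rightarrow> complex mat" where
  "map_matrix bs cs f =
     mat (length cs) (length bs) (\<lambda>(i, j). cfun.representation (set cs) (f (bs ! j)) (cs ! i))"

text \<open>Linearity is asked on all functions and not just on a representation space: the
  operators below are given by formulas that are linear everywhere.\<close>

definition clinear_map :: "(('x \<Rightarrow> complex) \<Rightarrow> 'y \<Rightarrow> complex) \<Rightarrow> bool" where
  "clinear_map f \<longleftrightarrow> Vector_Spaces.linear fscale fscale f"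

lemma clinear_mapI:
  assumes "\<And>x y. f (x + y) = f x + f y" "\<And>c x. f (fscale c x) = fscale c (f x)"
  shows "clinear_map f"
  unfolding clinear_map_def Vector_Spaces.linear_def module_hom_def module_hom_axioms_def
  by (intro conjI allI assms cfun.module_axioms cfun.vector_space_axioms)

lemma clinear_map_sum_fscale:
  assumes "clinear_map f"
  shows "f (\<Sum>i\<in>I. fscale (c i) (x i)) = (\<Sum>i\<in>I. fscale (c i) (f (x i)))"
proof -
  interpret f: Vector_Spaces.linear fscale fscale f
    using assms by (simp add: clinear_map_def)
  show ?thesis by (simp add: f.sum f.scale)
qed

text \<open>Expand \<open>f (bs ! j)\<close> in \<open>cs\<close>, apply the linear map
  \<open>g\<close> and read off the coordinate at \<open>ds ! i\<close>: this is an entry of the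
  matrix product.\<close>

lemma map_matrix_comp:
  assumes bs: "ordered_basis U bs" and cs: "ordered_basis V cs" and ds: "ordered_basis W ds"
    and f: "f ` U \<subseteq> V" and g: "g ` V \<subseteq> W" and lin: "clinear_map g"
  shows "map_matrix cs ds g * map_matrix bs cs f = map_matrix bs ds (\<lambda>x. g (f x))"
proof (rule eq_matI)
  fix i j
  assume "i < dim_row (map_matrix bs ds (\<lambda>x. g (f x)))" "j < dim_col (map_matrix bs ds (\<lambda>x. g (f x)))"
  then have i: "i < length ds" and j: "j < length bs" by (auto simp: map_matrix_def)
  let ?a = "\<lambda>c. cfun.representation (set cs) (f (bs ! j)) c"
  have dist: "distinct cs" and ind: "cfun.independent (set cs)" and sp: "cfun.span (set cs) = V"
    using cs by (auto simp: ordered_basis_def)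
  have indd: "cfun.independent (set ds)" and spd: "cfun.span (set ds) = W"
    using ds by (auto simp: ordered_basis_def)
  have "bs ! j \<in> U"
    using bs j cfun.span_base[of "bs ! j" "set bs"] by (auto simp: ordered_basis_def)
  then have fV: "f (bs ! j) \<in> cfun.span (set cs)" using f sp by auto
  have gW: "g c \<in> cfun.span (set ds)" if "c \<in> set cs" for c
    using that g sp spd cfun.span_base by blast
  have "f (bs ! j) = (\<Sum>c\<in>set cs. fscale (?a c) c)"
    by (rule cfun.sum_representation_eq[symmetric]) (use ind fV in auto)
  then have "g (f (bs ! j)) = (\<Sum>c\<in>set cs. fscale (?a c) (g c))"
    using clinear_map_sum_fscale[OF lin, of ?a "\<lambda>c. c" "set cs"] by simp
  then have "cfun.representation (set ds) (g (f (bs ! j))) (ds ! i) =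
      (\<Sum>c\<in>set cs. ?a c * cfun.representation (set ds) (g c) (ds ! i))"
    using gW indd
    by (simp add: cfun.representation_sum cfun.representation_scale cfun.span_scale)
  also have "\<dots> = (\<Sum>k<length cs. ?a (cs ! k) * cfun.representation (set ds) (g (cs ! k)) (ds ! i))"
    by (rule sum.reindex_bij_betw[symmetric]) (use dist in \<open>rule bij_betw_nth, auto\<close>)
  finally show "(map_matrix cs ds g * map_matrix bs cs f) $$ (i, j) =
      map_matrix bs ds (\<lambda>x. g (f x)) $$ (i, j)"
    using i j by (simp add: map_matrix_def scalar_prod_def atLeast0LessThan mult.commute)
qed (auto simp: map_matrix_def)

lemma map_matrix_id:
  assumes "ordered_basis V bs" and "\<And>x. x \<in> V \<Longrightarrow> f x = x"
  shows "map_matrix bs bs f = 1\<^sub>m (length bs)"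
proof (rule eq_matI)
  fix i j assume "i < dim_row (1\<^sub>m (length bs))" "j < dim_col (1\<^sub>m (length bs))"
  then have ij: "i < length bs" "j < length bs" by auto
  have "bs ! j \<in> V"
    using assms(1) ij cfun.span_base[of "bs ! j" "set bs"] by (auto simp: ordered_basis_def)
  then show "map_matrix bs bs f $$ (i, j) = 1\<^sub>m (length bs) $$ (i, j)"
    using ij assms
    by (auto simp: map_matrix_def ordered_basis_def cfun.representation_basis nth_eq_iff_index_eq)
qed (auto simp: map_matrix_def)

text \<open>An injective linear map sends a basis to an independent set, which is no larger than any
  finite spanning set. Used in both directions, it makes the matrices of an isomorphism
  square.\<close>

lemma ordered_basis_length_le:
  assumes bs: "ordered_basis U bs" and cs: "ordered_basis V cs"
    and f: "f ` U \<subseteq> V" and lin: "clinear_map f" and inj: "inj_on f U"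
  shows "length bs \<le> length cs"
proof -
  interpret f: Vector_Spaces.linear fscale fscale f
    using lin by (simp add: clinear_map_def)
  have inj': "inj_on f (cfun.span (set bs))" using inj bs by (auto simp: ordered_basis_def)
  have "cfun.independent (f ` set bs)"
    using f.independent_injective_image[OF _ inj'] bs by (auto simp: ordered_basis_def)
  moreover have "f ` set bs \<subseteq> cfun.span (set cs)"
    using bs cs f cfun.span_superset[of "set bs"] by (auto simp: ordered_basis_def)
  ultimately have "card (f ` set bs) \<le> card (set cs)"
    using cfun.independent_span_bound by auto
  moreover have "card (f ` set bs) = card (set bs)"
    using inj' cfun.span_superset by (intro card_image) (rule inj_on_subset)
  ultimately show ?thesis
    using bs cs by (simp add: ordered_basis_def distinct_card)
qed

text \<open>The matrices of \<open>f\<close> and \<open>g\<close> are inverse to each other and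
  conjugate the matrix of \<open>T\<close> into that of \<open>S\<close>; similar matrices have
  equal determinants.\<close>

lemma op_det_conjugate:
  assumes ex: "\<exists>bs. ordered_basis U bs" "\<exists>cs. ordered_basis V cs"
    and f: "f ` U \<subseteq> V" "clinear_map f" and g: "g ` V \<subseteq> U" "clinear_map g"
    and gf: "\<And>x. x \<in> U \<Longrightarrow> g (f x) = x" and fg: "\<And>y. y \<in> V \<Longrightarrow> f (g y) = y"
    and S: "S ` U \<subseteq> U" "clinear_map S" and T: "T ` V \<subseteq> V" "clinear_map T"
    and comm: "\<And>x. x \<in> U \<Longrightarrow> f (S x) = T (f x)"
  shows "op_det U S = op_det V T"
proof -
  \<comment> \<open>These are the bases that \<open>op_det\<close> itself picks, so no separate
    proof of independence of the basis is required.\<close>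
  define bs where "bs = (SOME bs. ordered_basis U bs)"
  define cs where "cs = (SOME cs. ordered_basis V cs)"
  have bs: "ordered_basis U bs" and cs: "ordered_basis V cs"
    unfolding bs_def cs_def using ex by (auto intro: someI_ex)
  have "inj_on f U" "inj_on g V"
    using gf fg by (auto intro: inj_on_inverseI)
  then have len: "length cs = length bs"
    using ordered_basis_length_le[OF bs cs f] ordered_basis_length_le[OF cs bs g] by simp
  let ?P = "map_matrix cs bs g" and ?Q = "map_matrix bs cs f"
  let ?A = "map_matrix bs bs S" and ?B = "map_matrix cs cs T"
  have SU: "x \<in> U \<Longrightarrow> S x \<in> U" for x using S by auto
  have "?P * ?B * ?Q = map_matrix bs bs (\<lambda>x. g (T (f x)))"
    using map_matrix_comp[OF cs cs bs T(1) g] f T g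
      map_matrix_comp[OF bs cs bs f(1), of "\<lambda>x. g (T x)"]
    by (simp add: image_subset_iff clinear_map_def Vector_Spaces.linear_compose[unfolded o_def])
  also have "\<dots> = ?A"
    unfolding map_matrix_def
  proof (rule cong_mat)
    fix i j assume "i < length bs" "j < length bs"
    then have "bs ! j \<in> U"
      using bs cfun.span_base[of "bs ! j" "set bs"] by (auto simp: ordered_basis_def)
    then have "g (T (f (bs ! j))) = S (bs ! j)"
      using comm[of "bs ! j"] gf[OF SU, of "bs ! j"] by metis
    then show "(case (i, j) of (i, j) \<Rightarrow> cfun.representation (set bs) (g (T (f (bs ! j)))) (bs ! i)) =
       (case (i, j) of (i, j) \<Rightarrow> cfun.representation (set bs) (S (bs ! j)) (bs ! i))"
      by simp
  qed auto
  finally have "?A = ?P * ?B * ?Q" ..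
  moreover have "?P * ?Q = 1\<^sub>m (length bs)"
    using map_matrix_comp[OF bs cs bs f(1) g] map_matrix_id[OF bs gf] by simp
  moreover have "?Q * ?P = 1\<^sub>m (length bs)"
    using map_matrix_comp[OF cs bs cs g(1) f] map_matrix_id[OF cs fg] len by simp
  ultimately have "similar_mat ?A ?B"
    unfolding similar_mat_def
    by (intro exI[of _ ?P] exI[of _ ?Q] similar_mat_witI[where n = "length bs"])
      (auto simp: map_matrix_def len)
  then have "det ?A = det ?B" by (rule det_similar)
  then show ?thesis
    by (simp add: op_det_def op_matrix_def map_matrix_def flip: bs_def cs_def)
qed

lemma sum_apply: "(\<Sum>i\<in>I. f i) x = (\<Sum>i\<in>I. f i x)"
  for f :: "'i \<Rightarrow> 'x \<Rightarrow> 'a::comm_monoid_add"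
  by (induction I rule: infinite_finite_induct) auto

text \<open>A criterion for finite dimension when the functions have an infinite domain: an element
  of \<open>V\<close> is a combination of the indicators of the fibres of \<open>red\<close> on
  \<open>P\<close>, and these are indexed by the finite set \<open>D\<close>.\<close>

lemma ordered_basis_exists:
  assumes sub: "cfun.subspace V" and fin: "finite D"
    and supp: "\<And>F x. F \<in> V \<Longrightarrow> \<not> P x \<Longrightarrow> F x = 0"
    and red: "\<And>F x. F \<in> V \<Longrightarrow> P x \<Longrightarrow> F x = F (red x)" "\<And>x. P x \<Longrightarrow> red x \<in> D"
  shows "\<exists>bs. ordered_basis V bs"
proof -
  define e where "e d = (\<lambda>x. if P x \<and> red x = d then 1 else 0 :: complex)" for d
  have "V \<subseteq> cfun.span (e ` D)"
  proof
    fix F assume F: "F \<in> V"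
    have "F = (\<Sum>d\<in>D. fscale (F d) (e d))"
    proof
      fix x
      have "(\<Sum>d\<in>D. fscale (F d) (e d)) x = (\<Sum>d\<in>D. if P x \<and> red x = d then F d else 0)"
        by (simp add: sum_apply fscale_def e_def if_distrib cong: if_cong)
      also have "\<dots> = F x"
        using supp[OF F, of x] red(1)[OF F, of x] red(2)[of x] fin by (cases "P x") simp_all
      finally show "F x = (\<Sum>d\<in>D. fscale (F d) (e d)) x" ..
    qed
    also have "\<dots> \<in> cfun.span (e ` D)"
      by (intro cfun.span_sum cfun.span_scale cfun.span_base) auto
    finally show "F \<in> cfun.span (e ` D)" .
  qed
  \<comment> \<open>The indicators \<open>e d\<close> need not lie in \<open>V\<close>; they only
    bound the size of an independent subset of \<open>V\<close>.\<close>
  moreover obtain B where B: "B \<subseteq> V" "cfun.independent B" "V \<subseteq> cfun.span B"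
    using cfun.maximal_independent_subset by blast
  ultimately have "finite B"
    using cfun.independent_span_bound[of "e ` D" B] fin by auto
  then obtain bs where "set bs = B" "distinct bs"
    using finite_distinct_list by blast
  moreover have "cfun.span B = V"
    using B sub cfun.span_minimal by blast
  ultimately show ?thesis
    using B by (auto simp: ordered_basis_def)
qed

section \<open>The groups \<open>G(n,r)\<close>\<close>

lemma gen_sym_group_carrier:
  assumes "r > 0"
  shows "carrier (gen_sym_group n r) = ({1..n} \<rightarrow>\<^sub>E {0..<int r}) \<times> {w. w permutes {1..n}}"
  using assms
  by (auto simp: gen_sym_group_def carrier_integer_mod_group sym_group_carrier)

lemma gen_sym_group_mult:
  assumes "w permutes {1..n}"
  shows "(x, w) \<otimes>\<^bsub>gen_sym_group n r\<^esub> (y, v) =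
    (\<lambda>i\<in>{1..n}. (x i + y (Hilbert_Choice.inv w i)) mod int r, w \<circ> v)"
  using assms by (auto simp: gen_sym_group_def sym_group_mult)

lemma gen_sym_group_mult_closed:
  assumes "r > 0" "g \<in> carrier (gen_sym_group n r)" "h \<in> carrier (gen_sym_group n r)"
  shows "g \<otimes>\<^bsub>gen_sym_group n r\<^esub> h \<in> carrier (gen_sym_group n r)"
  using assms
  by (cases g; cases h) (auto simp: gen_sym_group_carrier gen_sym_group_mult permutes_compose)

lemma inv_comp_permutes:
  assumes "v permutes A" "w permutes A"
  shows "Hilbert_Choice.inv (v \<circ> w) i = Hilbert_Choice.inv w (Hilbert_Choice.inv v i)"
  using o_inv_distrib[of v w] assms by (simp add: permutes_bij)

lemma gen_sym_group_assoc:
  assumes r: "r > 0" and f: "f \<in> carrier (gen_sym_group n r)"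
    and g: "g \<in> carrier (gen_sym_group n r)" and h: "h \<in> carrier (gen_sym_group n r)"
  shows "f \<otimes>\<^bsub>gen_sym_group n r\<^esub> g \<otimes>\<^bsub>gen_sym_group n r\<^esub> h =
    f \<otimes>\<^bsub>gen_sym_group n r\<^esub> (g \<otimes>\<^bsub>gen_sym_group n r\<^esub> h)"
proof -
  obtain x u y v z w where fgh: "f = (x, u)" "g = (y, v)" "h = (z, w)"
    by (cases f; cases g; cases h) auto
  have p: "u permutes {1..n}" "v permutes {1..n}" "w permutes {1..n}"
    using f g h r by (auto simp: fgh gen_sym_group_carrier)
  \<comment> \<open>Lets the simplifier evaluate the restricted functions that arise in nested
    products.\<close>
  have "Hilbert_Choice.inv u i \<in> {1..n} \<longleftrightarrow> i \<in> {1..n}" for i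
    using permutes_in_image[OF permutes_inv[OF p(1)]] by blast
  then show ?thesis
    using p
    by (auto simp: fgh gen_sym_group_mult permutes_compose inv_comp_permutes fun_eq_iff mod_simps add_ac
        cong: restrict_cong)
qed

text \<open>
  \<open>shift_map n r u \<tau>\<close> is the composition of left translation by \<open>(0, \<tau>)\<close> with the automorphism
  \<open>(x, w) \<mapsto> (u x, w)\<close>; the latter is \<open>shift_map n r u id\<close>.
\<close>

definition shift_map :: "nat \<Rightarrow> nat \<Rightarrow> nat \<Rightarrow> (nat \<Rightarrow> nat) \<Rightarrow> gelem \<Rightarrow> gelem" where
  "shift_map n r u \<tau> = (\<lambda>(x, w).
     (\<lambda>i\<in>{1..n}. int u * x (Hilbert_Choice.inv \<tau> i) mod int r, \<tau> \<circ> w))"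

text \<open>The automorphism \<open>(x, w) \<mapsto> (u x, w)\<close> followed by conjugation with
  \<open>(0, \<tau>)\<close>.\<close>

definition conj_map :: "nat \<Rightarrow> nat \<Rightarrow> nat \<Rightarrow> (nat \<Rightarrow> nat) \<Rightarrow> gelem \<Rightarrow> gelem" where
  "conj_map n r u \<tau> = (\<lambda>(x, w).
     (\<lambda>i\<in>{1..n}. int u * x (Hilbert_Choice.inv \<tau> i) mod int r, \<tau> \<circ> w \<circ> Hilbert_Choice.inv \<tau>))"

lemma shift_map_closed:
  assumes "r > 0" "\<tau> permutes {1..n}" "g \<in> carrier (gen_sym_group n r)"
  shows "shift_map n r u \<tau> g \<in> carrier (gen_sym_group n r)"
  using assms by (cases g) (auto simp: gen_sym_group_carrier shift_map_def permutes_compose)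

text \<open>Left translation only affects the left factor, so the right one sees the automorphism
  alone. This makes the intertwiner compatible with right translations.\<close>

lemma shift_map_mult_right:
  assumes r: "r > 0" and t: "\<tau> permutes {1..n}"
    and g: "g \<in> carrier (gen_sym_group n r)" and h: "h \<in> carrier (gen_sym_group n r)"
  shows "shift_map n r u \<tau> (g \<otimes>\<^bsub>gen_sym_group n r\<^esub> h) =
    shift_map n r u \<tau> g \<otimes>\<^bsub>gen_sym_group n r\<^esub> shift_map n r u id h"
proof -
  obtain x w y v where gh: "g = (x, w)" "h = (y, v)" by (cases g; cases h) auto
  have p: "w permutes {1..n}" "v permutes {1..n}"
    using g h r by (auto simp: gh gen_sym_group_carrier)
  have "Hilbert_Choice.inv \<tau> i \<in> {1..n} \<longleftrightarrow> i \<in> {1..n}"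
    "Hilbert_Choice.inv w i \<in> {1..n} \<longleftrightarrow> i \<in> {1..n}" for i
    using permutes_in_image[OF permutes_inv[OF p(1)]] permutes_in_image[OF permutes_inv[OF t]]
    by blast+
  then show ?thesis
    using p t
    by (auto simp: gh shift_map_def gen_sym_group_mult permutes_compose inv_comp_permutes fun_eq_iff
        mod_simps algebra_simps cong: restrict_cong)
qed

text \<open>Moving \<open>(0, \<tau>)\<close> past the left factor conjugates that factor. This
  yields the equivariance under block subgroups.\<close>

lemma shift_map_mult_left:
  assumes r: "r > 0" and t: "\<tau> permutes {1..n}"
    and g: "g \<in> carrier (gen_sym_group n r)" and h: "h \<in> carrier (gen_sym_group n r)"
  shows "shift_map n r u \<tau> (h \<otimes>\<^bsub>gen_sym_group n r\<^esub> g) =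
    conj_map n r u \<tau> h \<otimes>\<^bsub>gen_sym_group n r\<^esub> shift_map n r u \<tau> g"
proof -
  obtain x w y v where gh: "h = (x, w)" "g = (y, v)" by (cases g; cases h) auto
  have p: "w permutes {1..n}" "v permutes {1..n}" "Hilbert_Choice.inv \<tau> permutes {1..n}"
    using g h r t by (auto simp: gh gen_sym_group_carrier permutes_inv)
  have "Hilbert_Choice.inv \<tau> i \<in> {1..n} \<longleftrightarrow> i \<in> {1..n}"
    "Hilbert_Choice.inv w i \<in> {1..n} \<longleftrightarrow> i \<in> {1..n}" 
    "\<tau> i \<in> {1..n} \<longleftrightarrow> i \<in> {1..n}" for i
    using permutes_in_image[OF permutes_inv[OF p(1)]] permutes_in_image[OF permutes_inv[OF t]]
      permutes_in_image[OF t]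
    by blast+
  moreover have c: "Hilbert_Choice.inv (\<tau> \<circ> w \<circ> Hilbert_Choice.inv \<tau>) i =
      \<tau> (Hilbert_Choice.inv w (Hilbert_Choice.inv \<tau> i))" for i
    using p t by (simp add: inv_comp_permutes[of _ "{1..n}"] permutes_compose permutes_inv_inv)
  ultimately show ?thesis
    using p t
    by (auto simp: gh shift_map_def conj_map_def gen_sym_group_mult permutes_compose fun_eq_iff
        permutes_inverses mod_simps algebra_simps simp del: o_apply cong: restrict_cong)
      (auto simp: permutes_inverses)
qed

text \<open>The automorphism fixes \<open>(0, \<tau>)\<close>, hence commutes with the translation,
  and each of the two can be inverted separately.\<close>

lemma shift_map_inverse:
  assumes r: "r > 0" and t: "\<tau> permutes {1..n}" and uv: "u * v mod r = 1 mod r"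
    and g: "g \<in> carrier (gen_sym_group n r)"
  shows "shift_map n r v (Hilbert_Choice.inv \<tau>) (shift_map n r u \<tau> g) = g"
proof -
  obtain x w where gx: "g = (x, w)" by (cases g) auto
  have x: "x \<in> {1..n} \<rightarrow>\<^sub>E {0..<int r}" and w: "w permutes {1..n}"
    using g r by (auto simp: gx gen_sym_group_carrier)
  have uv': "int v * int u mod int r = 1 mod int r"
    using uv by (metis mult.commute of_nat_1 of_nat_mult zmod_int)
  have "int v * (int u * a mod int r) mod int r = a mod int r" for a
    using uv' by (metis mod_mult_left_eq mod_mult_right_eq mult.assoc mult_1)
  moreover have "\<tau> i \<in> {1..n} \<longleftrightarrow> i \<in> {1..n}" for i
    using permutes_in_image[OF t] by blast
  ultimately show ?thesis
    using x t
    by (auto simp: gx shift_map_def fun_eq_iff permutes_inverses permutes_inv_inv PiE_iff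
        extensional_def restrict_def)
qed

section \<open>The characters under the automorphism\<close>

lemma powi_cong_mod:
  fixes \<zeta> :: complex
  assumes "\<zeta> ^ r = 1" "r > 0" "a mod int r = b mod int r"
  shows "\<zeta> powi a = \<zeta> powi b"
proof -
  have z: "\<zeta> \<noteq> 0" using assms by (auto simp: power_0_left)
  have "\<zeta> powi c = \<zeta> powi (c mod int r)" for c
  proof -
    have "\<zeta> powi c = \<zeta> powi (int r * (c div int r) + c mod int r)" by simp
    also have "\<dots> = (\<zeta> powi int r) powi (c div int r) * \<zeta> powi (c mod int r)"
      using z by (simp only: power_int_add power_int_mult simp_thms)
    finally show ?thesis using assms by simp
  qed
  then show ?thesis using assms(3) by metis
qed

text \<open>An \<open>r\<close>-th root of unity does not notice the reduction of the coordinates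
  modulo \<open>r\<close>, so scaling them by \<open>u\<close> scales the exponent.\<close>

lemma zeta_char_shift_map:
  assumes "\<zeta> ^ r = 1" "r > 0"
  shows "zeta_char \<zeta> n (shift_map n r u id g) = zeta_char \<zeta> n g ^ u"
proof (cases g)
  case (Pair x w)
  have "zeta_char \<zeta> n (shift_map n r u id g) = \<zeta> powi (\<Sum>i\<in>{1..n}. int u * x i mod int r)"
    by (simp add: Pair zeta_char_def shift_map_def)
  also have "\<dots> = \<zeta> powi ((\<Sum>i\<in>{1..n}. x i) * int u)"
    by (rule powi_cong_mod[OF assms]) (simp add: mod_sum_eq sum_distrib_left mult.commute)
  also have "\<dots> = zeta_char \<zeta> n g ^ u"
    by (simp add: Pair zeta_char_def power_int_mult)
  finally show ?thesis .
qed

lemma sgn_char_shift_map: "sgn_char (shift_map n r u id g) = sgn_char g"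
  by (cases g) (simp add: sgn_char_def shift_map_def)

lemma zeta_char_power_cong:
  assumes "\<zeta> ^ r = 1" "a mod r = b mod r"
  shows "zeta_char \<zeta> n g ^ a = zeta_char \<zeta> n g ^ b"
proof -
  have one: "zeta_char \<zeta> n g ^ r = 1"
  proof (cases g)
    case (Pair x w)
    have "zeta_char \<zeta> n g ^ r = (\<zeta> ^ r) powi (\<Sum>i\<in>{1..n}. x i)"
      by (simp add: Pair zeta_char_def power_int_power power_int_power' mult.commute)
    then show ?thesis by (simp add: assms)
  qed
  have "zeta_char \<zeta> n g ^ c = zeta_char \<zeta> n g ^ (c mod r)" for c
  proof -
    have "zeta_char \<zeta> n g ^ c = zeta_char \<zeta> n g ^ (r * (c div r) + c mod r)" by simp
    also have "\<dots> = zeta_char \<zeta> n g ^ (c mod r)"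
      by (simp only: power_add power_mult one power_one mult_1)
    finally show ?thesis .
  qed
  then show ?thesis using assms(2) by metis
qed

section \<open>The spaces of the induced representations\<close>

abbreviation tensor_rep :: "complex \<Rightarrow> nat \<Rightarrow> nat list list \<Rightarrow> (nat \<Rightarrow> gelem, nat \<Rightarrow> nat \<Rightarrow> nat) crep" where
  "tensor_rep \<zeta> r lam \<equiv> ext_tensor r (\<lambda>k. ext_specht_rep \<zeta> k (lam ! k))"

text \<open>Each slot acts on its own variable only, so the successive operators collect into one
  scalar and one simultaneous substitution.\<close>

lemma fold_apply_slot_left_mult:
  "fold (\<lambda>k. apply_slot k (\<lambda>f. fscale (c k) (left_mult (w k) f))) [0..<m] F =
    (\<lambda>X :: nat \<Rightarrow> nat \<Rightarrow> nat. (\<Prod>k<m. c k) * F (\<lambda>k. if k < m then Hilbert_Choice.inv (w k) \<circ> X k else X k))"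
proof (induction m)
  case (Suc m)
  show ?case
  proof
    fix X :: "nat \<Rightarrow> nat \<Rightarrow> nat"
    \<comment> \<open>The outermost operator, for slot \<open>m\<close>, evaluates the result for
      the first \<open>m\<close> slots at \<open>?Y\<close>.\<close>
    let ?Y = "X(m := Hilbert_Choice.inv (w m) \<circ> X m)"
    have "(\<lambda>k. if k < m then Hilbert_Choice.inv (w k) \<circ> ?Y k else ?Y k) =
      (\<lambda>k. if k < Suc m then Hilbert_Choice.inv (w k) \<circ> X k else X k)"
      by (auto simp: fun_eq_iff less_Suc_eq)
    then show "fold (\<lambda>k. apply_slot k (\<lambda>f. fscale (c k) (left_mult (w k) f))) [0..<Suc m] F X =
      (\<Prod>k<Suc m. c k) * F (\<lambda>k. if k < Suc m then Hilbert_Choice.inv (w k) \<circ> X k else X k)"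
      by (simp add: Suc.IH) (simp add: apply_slot_def fscale_def left_mult_def mult_ac)
  qed
qed simp

lemma tensor_rep_act:
  "rep_act (tensor_rep \<zeta> r lam) P F =
    (\<lambda>X. (\<Prod>k<r. zeta_char \<zeta> (sum_list (lam ! k)) (P k) ^ k) *
      F (\<lambda>k. if k < r then Hilbert_Choice.inv (snd (P k)) \<circ> X k else X k))"
  using fold_apply_slot_left_mult[of "\<lambda>k. zeta_char \<zeta> (sum_list (lam ! k)) (P k) ^ k" "\<lambda>k. snd (P k)" r F]
  by (simp add: ext_tensor_def ext_specht_rep_def specht_rep_def)

lemma subspace_tensor_rep: "cfun.subspace (rep_space (tensor_rep \<zeta> r lam))"
  by (simp add: ext_tensor_def cfun.subspace_span)

section \<open>Supports of the functions in the representation spaces\<close>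

lemma young_symmetrizer_support:
  assumes "\<not> w permutes {1..sum_list \<mu>}"
  shows "young_symmetrizer \<mu> w = 0"
  unfolding young_symmetrizer_def
proof (intro sum.neutral ballI)
  fix p q assume "p \<in> row_group \<mu>" "q \<in> col_group \<mu>"
  then have "p \<circ> q permutes {1..sum_list \<mu>}"
    by (auto simp: row_group_def col_group_def permutes_compose)
  then show "(if w = p \<circ> q then of_int (sign q) else 0 :: complex) = 0"
    using assms by auto
qed

text \<open>Vanishing at \<open>v\<close> is a linear condition, so it suffices to check the
  generators, and left translation by a permutation of \<open>{1..sum_list \<mu>}\<close> preserves
  the support.\<close>

lemma specht_rep_support:
  assumes "f \<in> rep_space (specht_rep \<mu>)" "\<not> v permutes {1..sum_list \<mu>}"
  shows "f v = 0"
proof -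
  let ?Z = "{f :: (nat \<Rightarrow> nat) \<Rightarrow> complex. f v = 0}"
  have "left_mult w (young_symmetrizer \<mu>) v = 0" if w: "w permutes {1..sum_list \<mu>}" for w
  proof -
    have "v = w \<circ> (Hilbert_Choice.inv w \<circ> v)"
      using permutes_inverses[OF w] by (simp add: fun_eq_iff)
    then have "\<not> Hilbert_Choice.inv w \<circ> v permutes {1..sum_list \<mu>}"
      using permutes_compose[OF _ w] assms(2) by metis
    then show ?thesis by (simp add: left_mult_def young_symmetrizer_support)
  qed
  then have "rep_space (specht_rep \<mu>) \<subseteq> ?Z"
    unfolding specht_rep_def crep.simps
    by (intro cfun.span_minimal) (auto simp: cfun.subspace_def fscale_def sym_group_carrier)
  then show ?thesis using assms(1) by auto
qed

lemma tensor_rep_support: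
  assumes "F \<in> rep_space (tensor_rep \<zeta> r lam)" "k < r" "\<not> X k permutes {1..sum_list (lam ! k)}"
  shows "F X = 0"
proof -
  have "rep_space (tensor_rep \<zeta> r lam) \<subseteq> {F. F X = 0}"
    unfolding ext_tensor_def crep.simps
  proof (rule cfun.span_minimal)
    show "{pure_tensor r f |f. \<forall>k<r. f k \<in> rep_space (ext_specht_rep \<zeta> k (lam ! k))} \<subseteq> {F. F X = 0}"
      using assms(2,3) specht_rep_support
      by (fastforce simp: pure_tensor_def ext_specht_rep_def)
  qed (auto simp: cfun.subspace_def fscale_def)
  then show ?thesis using assms(1) by auto
qed

text \<open>Pure tensors read only the variables below \<open>r\<close>. Together with the support
  condition this leaves finitely many relevant arguments.\<close>

lemma tensor_rep_restrict:
  assumes "F \<in> rep_space (tensor_rep \<zeta> r lam)"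
  shows "F (restrict X {..<r}) = F X"
proof -
  have "rep_space (tensor_rep \<zeta> r lam) \<subseteq> {F. F (restrict X {..<r}) = F X}"
    unfolding ext_tensor_def crep.simps
    by (rule cfun.span_minimal) (auto simp: cfun.subspace_def fscale_def pure_tensor_def)
  then show ?thesis using assms by auto
qed

section \<open>Blocks and the pointwise form of the induced representation\<close>

lemma block_start_Suc:
  "k < length a \<Longrightarrow> block_start a (Suc k) = block_start a k + a ! k"
  by (simp add: block_start_def take_Suc_conv_app_nth)

lemma block_start_le: "block_start a k \<le> sum_list a"
  using sum_list_append[of "take k a" "drop k a"] by (simp add: block_start_def)

lemma block_start_add_mem:
  assumes "k < length a" "i \<in> {1..a ! k}"
  shows "block_start a k + i \<in> {1..sum_list a}"
  using assms block_start_Suc[of k a] block_start_le[of a "Suc k"] by auto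

lemma block_subgroup_carrier:
  "h \<in> block_subgroup r a \<Longrightarrow> h \<in> carrier (gen_sym_group (sum_list a) r)"
  by (auto simp: block_subgroup_def)

text \<open>\<open>block_char\<close> and \<open>block_move\<close> are the scalar and the
  substitution by which a block element acts on the tensor space, as read off from
  \<open>tensor_rep_act\<close>.\<close>

definition block_char :: "complex \<Rightarrow> nat \<Rightarrow> nat list list \<Rightarrow> gelem \<Rightarrow> complex" where
  "block_char \<zeta> r lam h =
    (\<Prod>k<r. zeta_char \<zeta> (sum_list (lam ! k)) (block_proj (map sum_list lam) h k) ^ k)"

definition block_move :: "nat \<Rightarrow> nat list list \<Rightarrow> gelem \<Rightarrow> (nat \<Rightarrow> nat \<Rightarrow> nat) \<Rightarrow> nat \<Rightarrow> nat \<Rightarrow> nat" where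
  "block_move r lam h X =
    (\<lambda>k. if k < r then Hilbert_Choice.inv (snd (block_proj (map sum_list lam) h k)) \<circ> X k else X k)"

text \<open>Turns equivariance into a pointwise identity, so that later arguments need no operators
  on the tensor space.\<close>

lemma irrep_space:
  fixes lam :: "nat list list" and r :: nat
  defines "a \<equiv> map sum_list lam"
  defines "G \<equiv> gen_sym_group (sum_list a) r"
  shows "F \<in> rep_space (irrep \<zeta> r lam) \<longleftrightarrow>
    (\<forall>g y. g \<notin> carrier G \<longrightarrow> F (g, y) = 0) \<and>
    (\<forall>g\<in>carrier G. (\<lambda>y. F (g, y)) \<in> rep_space (tensor_rep \<zeta> r lam)) \<and>
    (\<forall>h\<in>block_subgroup r a. \<forall>g\<in>carrier G. \<forall>X.
      F (h \<otimes>\<^bsub>G\<^esub> g, X) = block_char \<zeta> r lam h * F (g, block_move r lam h X))"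
  by (simp add: irrep_def Let_def induced_rep_def pullback_rep_def tensor_rep_act fun_eq_iff
      a_def G_def block_char_def block_move_def)

lemma irrep_act:
  "rep_act (irrep \<zeta> r lam) g F = (\<lambda>(g', y).
    if g' \<in> carrier (gen_sym_group (sum_list (map sum_list lam)) r)
    then F (g' \<otimes>\<^bsub>gen_sym_group (sum_list (map sum_list lam)) r\<^esub> g, y) else 0)"
  by (simp add: irrep_def Let_def induced_rep_def fun_eq_iff)

lemma clinear_irrep_act: "clinear_map (rep_act (irrep \<zeta> r lam) g)"
  by (rule clinear_mapI) (auto simp: irrep_act fscale_def fun_eq_iff)

lemma subspace_irrep: "cfun.subspace (rep_space (irrep \<zeta> r lam))"
  unfolding cfun.subspace_def
proof (intro conjI ballI allI)
  note sub = subspace_tensor_rep[of r \<zeta> lam]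
  show "0 \<in> rep_space (irrep \<zeta> r lam)"
    using cfun.subspace_0[OF sub] by (simp add: irrep_space zero_fun_def)
  fix F assume F: "F \<in> rep_space (irrep \<zeta> r lam)"
  show "F + F' \<in> rep_space (irrep \<zeta> r lam)" if "F' \<in> rep_space (irrep \<zeta> r lam)" for F'
    using F that cfun.subspace_add[OF sub]
    by (simp add: irrep_space plus_fun_def distrib_left)
  show "fscale c F \<in> rep_space (irrep \<zeta> r lam)" for c
    using F cfun.subspace_scale[OF sub]
    by (simp add: irrep_space fscale_def)
qed

text \<open>Right translation commutes with left multiplication by block elements, by
  associativity.\<close>

lemma irrep_act_closed:
  assumes "r > 0" "g \<in> carrier (gen_sym_group (sum_list (map sum_list lam)) r)"
  shows "rep_act (irrep \<zeta> r lam) g ` rep_space (irrep \<zeta> r lam) \<subseteq> rep_space (irrep \<zeta> r lam)"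
proof clarify
  let ?G = "gen_sym_group (sum_list (map sum_list lam)) r"
  fix F assume F: "F \<in> rep_space (irrep \<zeta> r lam)"
  have "F (h \<otimes>\<^bsub>?G\<^esub> g' \<otimes>\<^bsub>?G\<^esub> g, X) =
      block_char \<zeta> r lam h * F (g' \<otimes>\<^bsub>?G\<^esub> g, block_move r lam h X)"
    if "h \<in> block_subgroup r (map sum_list lam)" "g' \<in> carrier ?G" for h g' X
    using F assms that block_subgroup_carrier[OF that(1)]
    by (simp add: irrep_space gen_sym_group_assoc gen_sym_group_mult_closed)
  then show "rep_act (irrep \<zeta> r lam) g F \<in> rep_space (irrep \<zeta> r lam)"
    using F assms block_subgroup_carrier[of _ r "map sum_list lam"]
    by (simp add: irrep_space irrep_act gen_sym_group_mult_closed)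
qed

text \<open>The support and the irrelevance of the variables from \<open>r\<close> on leave the
  finite set of restricted arguments required by \<open>ordered_basis_exists\<close>.\<close>

lemma irrep_ordered_basis:
  assumes r: "r > 0"
  shows "\<exists>bs. ordered_basis (rep_space (irrep \<zeta> r lam)) bs"
proof (rule ordered_basis_exists[where
      P = "\<lambda>(g, X). g \<in> carrier (gen_sym_group (sum_list (map sum_list lam)) r) \<and>
        (\<forall>k<r. X k permutes {1..sum_list (lam ! k)})" and
      red = "\<lambda>(g, X). (g, restrict X {..<r})" and
      D = "carrier (gen_sym_group (sum_list (map sum_list lam)) r) \<times>
        PiE {..<r} (\<lambda>k. {v. v permutes {1..sum_list (lam ! k)}})"])
  show "finite (carrier (gen_sym_group (sum_list (map sum_list lam)) r) \<times>
        PiE {..<r} (\<lambda>k. {v. v permutes {1..sum_list (lam ! k)}}))"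
    unfolding gen_sym_group_carrier[OF r]
    by (intro finite_cartesian_product finite_PiE finite_permutations) auto
  fix F and x :: "gelem \<times> (nat \<Rightarrow> nat \<Rightarrow> nat)"
  assume F: "F \<in> rep_space (irrep \<zeta> r lam)"
  obtain g X where x: "x = (g, X)" by (cases x)
  show "F x = 0" if "\<not> (case x of (g, X) \<Rightarrow>
      g \<in> carrier (gen_sym_group (sum_list (map sum_list lam)) r) \<and>
      (\<forall>k<r. X k permutes {1..sum_list (lam ! k)}))"
  proof (cases "g \<in> carrier (gen_sym_group (sum_list (map sum_list lam)) r)")
    case True
    then have "(\<lambda>y. F (g, y)) \<in> rep_space (tensor_rep \<zeta> r lam)"
      using F by (simp add: irrep_space)
    then show ?thesis
      using that tensor_rep_support[of "\<lambda>y. F (g, y)" r \<zeta> lam _ X] True by (auto simp: x)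
  qed (use F in \<open>cases g; simp add: irrep_space x\<close>)
  show "F x = F (case x of (g, X) \<Rightarrow> (g, restrict X {..<r}))" if "case x of (g, X) \<Rightarrow>
      g \<in> carrier (gen_sym_group (sum_list (map sum_list lam)) r) \<and>
      (\<forall>k<r. X k permutes {1..sum_list (lam ! k)})"
    using that F tensor_rep_restrict[of "\<lambda>y. F (g, y)" r \<zeta> lam X] by (simp add: irrep_space x)
qed (auto simp: subspace_irrep)

section \<open>The intertwining operator\<close>

text \<open>The data of a twist by \<open>u\<close>, with \<open>v\<close> its inverse modulo
  \<open>r\<close>. By \<open>u_pi\<close> the twist turns the exponent \<open>\<pi> k\<close> into
  \<open>k\<close>, so \<open>\<pi>\<close> is multiplication by \<open>v\<close> on residues. The
  permutation \<open>\<tau>\<close> carries block \<open>k\<close> of \<open>lam'\<close> to block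
  \<open>\<pi> k\<close> of \<open>lam\<close>, keeping the offsets.\<close>

locale reindexing =
  fixes \<zeta> :: complex and r u v :: nat and \<pi> \<tau> :: "nat \<Rightarrow> nat" and lam lam' :: "nat list list"
  assumes r_pos: "r > 0" and zeta: "\<zeta> ^ r = 1" and uv: "u * v mod r = 1 mod r"
    and perm_pi: "\<pi> permutes {..<r}" and u_pi: "\<And>k. k < r \<Longrightarrow> u * \<pi> k mod r = k"
    and length_lam: "length lam = r" "length lam' = r"
    and nth_lam': "\<And>k. k < r \<Longrightarrow> lam' ! k = lam ! \<pi> k"
    and sum_lam': "sum_list (map sum_list lam') = sum_list (map sum_list lam)"
    and perm_tau: "\<tau> permutes {1..sum_list (map sum_list lam)}"
    and tau_block: "\<And>k i. k < r \<Longrightarrow> i \<in> {1..sum_list (lam' ! k)} \<Longrightarrow>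
      \<tau> (block_start (map sum_list lam') k + i) = block_start (map sum_list lam) (\<pi> k) + i"
begin

abbreviation "size_lam \<equiv> sum_list (map sum_list lam)"
abbreviation "G \<equiv> gen_sym_group size_lam r"

lemma pi_less: "k < r \<Longrightarrow> \<pi> k < r"
  using permutes_in_image[OF perm_pi, of k] by simp

lemma inv_pi_less: "k < r \<Longrightarrow> Hilbert_Choice.inv \<pi> k < r"
  using permutes_in_image[OF permutes_inv[OF perm_pi], of k] by simp

text \<open>The data are symmetric, so whatever is shown for the intertwiner also holds for its
  inverse.\<close>

lemma reindexing_inverse: "reindexing \<zeta> r v u (Hilbert_Choice.inv \<pi>) (Hilbert_Choice.inv \<tau>) lam' lam"
proof
  show "v * u mod r = 1 mod r" using uv by (simp add: mult.commute)
  show "v * Hilbert_Choice.inv \<pi> k mod r = k" if "k < r" for k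
  proof -
    have "Hilbert_Choice.inv \<pi> k = u * k mod r"
      using u_pi[OF inv_pi_less[OF that]] permutes_inverses[OF perm_pi] by simp
    then have "v * Hilbert_Choice.inv \<pi> k mod r = u * v * k mod r"
      by (simp add: mod_mult_right_eq mult_ac)
    also have "\<dots> = k" using uv that by (metis mod_less mod_mult_left_eq mult_1)
    finally show ?thesis .
  qed
  show "lam ! k = lam' ! Hilbert_Choice.inv \<pi> k" if "k < r" for k
    using nth_lam'[OF inv_pi_less[OF that]] permutes_inverses[OF perm_pi] by simp
  fix k i assume "k < r" "i \<in> {1..sum_list (lam ! k)}"
  then have "\<tau> (block_start (map sum_list lam') (Hilbert_Choice.inv \<pi> k) + i) =
      block_start (map sum_list lam) k + i"
    using tau_block[OF inv_pi_less] nth_lam'[OF inv_pi_less] permutes_inverses[OF perm_pi] by simp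
  then show "Hilbert_Choice.inv \<tau> (block_start (map sum_list lam) k + i) =
      block_start (map sum_list lam') (Hilbert_Choice.inv \<pi> k) + i"
    using permutes_inverses[OF perm_tau] by metis
qed (use r_pos zeta length_lam sum_lam' permutes_inv[OF perm_pi] permutes_inv[OF perm_tau] in simp_all)

lemma tau_image_block:
  assumes "k < r"
  shows "\<tau> ` {block_start (map sum_list lam') k <.. block_start (map sum_list lam') (Suc k)} =
    {block_start (map sum_list lam) (\<pi> k) <.. block_start (map sum_list lam) (Suc (\<pi> k))}"
proof -
  have eq: "{s<..s + m} = (\<lambda>i. s + i) ` {1..m}" for s m :: nat
    unfolding image_add_atLeastAtMost by auto
  have "\<tau> ` (\<lambda>i. block_start (map sum_list lam') k + i) ` {1..sum_list (lam' ! k)} =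
      (\<lambda>i. block_start (map sum_list lam) (\<pi> k) + i) ` {1..sum_list (lam' ! k)}"
    unfolding image_image by (rule image_cong[OF refl]) (rule tau_block[OF assms])
  then show ?thesis
    using assms nth_lam' length_lam pi_less by (simp add: block_start_Suc eq)
qed

text \<open>As \<open>\<tau>\<close> carries blocks to blocks, conjugation by it carries the
  stabiliser of one block decomposition into that of the other.\<close>

lemma conj_map_block_subgroup:
  assumes "h \<in> block_subgroup r (map sum_list lam')"
  shows "conj_map size_lam r u \<tau> h \<in> block_subgroup r (map sum_list lam)"
proof -
  obtain x w where h: "h = (x, w)" by (cases h)
  have w: "w permutes {1..size_lam}" and
    wB: "\<And>k. k < r \<Longrightarrow> w ` {block_start (map sum_list lam') k <.. block_start (map sum_list lam') (Suc k)} =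
      {block_start (map sum_list lam') k <.. block_start (map sum_list lam') (Suc k)}"
    using assms r_pos length_lam by (auto simp: h block_subgroup_def sum_lam' gen_sym_group_carrier)
  have "(\<tau> \<circ> w \<circ> Hilbert_Choice.inv \<tau>) `
      {block_start (map sum_list lam) j <.. block_start (map sum_list lam) (Suc j)} =
      {block_start (map sum_list lam) j <.. block_start (map sum_list lam) (Suc j)}" if "j < r" for j
  proof -
    let ?B = "{block_start (map sum_list lam') (Hilbert_Choice.inv \<pi> j) <..
      block_start (map sum_list lam') (Suc (Hilbert_Choice.inv \<pi> j))}"
    have B: "{block_start (map sum_list lam) j <.. block_start (map sum_list lam) (Suc j)} = \<tau> ` ?B"
      using tau_image_block[OF inv_pi_less[OF that]] permutes_inverses[OF perm_pi] by simp
    have "(\<tau> \<circ> w \<circ> Hilbert_Choice.inv \<tau>) ` \<tau> ` ?B = \<tau> ` w ` ?B"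
      using permutes_inverses[OF perm_tau] by (simp add: image_image)
    then show ?thesis unfolding B wB[OF inv_pi_less[OF that]] .
  qed
  moreover have "conj_map size_lam r u \<tau> h \<in> carrier G"
    using w perm_tau r_pos
    by (auto simp: h conj_map_def gen_sym_group_carrier permutes_compose permutes_inv)
  ultimately show ?thesis
    using length_lam by (auto simp: block_subgroup_def conj_map_def h)
qed

text \<open>Since \<open>\<tau>\<close> keeps offsets within blocks, conjugation merely relabels the
  components; the scaling by \<open>u\<close> acts on each of them.\<close>

lemma block_proj_conj_map:
  assumes h: "h \<in> block_subgroup r (map sum_list lam')" and k: "k < r"
  shows "block_proj (map sum_list lam) (conj_map size_lam r u \<tau> h) (\<pi> k) =
    shift_map (sum_list (lam' ! k)) r u id (block_proj (map sum_list lam') h k)"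
proof -
  obtain x w where xw: "h = (x, w)" by (cases h)
  let ?s' = "block_start (map sum_list lam') k" and ?s = "block_start (map sum_list lam) (\<pi> k)"
  let ?m = "sum_list (lam' ! k)"
  have wB: "w ` {?s'<..?s' + ?m} = {?s'<..?s' + ?m}"
    using h k length_lam by (auto simp: xw block_subgroup_def block_start_Suc)
  have inv: "Hilbert_Choice.inv \<tau> (?s + i) = ?s' + i" and mem: "?s + i \<in> {1..size_lam}"
    and move: "\<tau> (w (?s' + i)) - ?s = w (?s' + i) - ?s'" if i: "i \<in> {1..?m}" for i
  proof -
    show "Hilbert_Choice.inv \<tau> (?s + i) = ?s' + i"
      using tau_block[OF k i] permutes_inverses[OF perm_tau] by metis
    show "?s + i \<in> {1..size_lam}"
      using block_start_add_mem[of "\<pi> k" "map sum_list lam" i] i k pi_less length_lam nth_lam' by simp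
    have "w (?s' + i) \<in> {?s'<..?s' + ?m}" using wB i by auto
    \<comment> \<open>\<open>w\<close> keeps the point in its block, so neither subtraction
      truncates and both sides equal \<open>j\<close>.\<close>
    then obtain j where "w (?s' + i) = ?s' + j" "j \<in> {1..?m}"
      by (intro that[of "w (?s' + i) - ?s'"]) auto
    then show "\<tau> (w (?s' + i)) - ?s = w (?s' + i) - ?s'" using tau_block[OF k] by simp
  qed
  have len: "\<pi> k < length lam" "k < length lam'" using length_lam k pi_less by auto
  show ?thesis
    using inv mem move len nth_lam'[OF k]
    by (auto simp: xw block_proj_def conj_map_def shift_map_def fun_eq_iff simp del: atLeastAtMost_iff)
qed

text \<open>Scaling coordinates does not touch the permutation parts, so only the relabelling by
  \<open>\<pi>\<close> remains.\<close>

lemma block_move_conj_map: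
  assumes "h \<in> block_subgroup r (map sum_list lam')"
  shows "block_move r lam (conj_map size_lam r u \<tau> h) (X \<circ> Hilbert_Choice.inv \<pi>) =
    block_move r lam' h X \<circ> Hilbert_Choice.inv \<pi>"
proof
  fix j
  have out: "Hilbert_Choice.inv \<pi> j < r \<longleftrightarrow> j < r"
    using permutes_in_image[OF permutes_inv[OF perm_pi], of j] by simp
  show "block_move r lam (conj_map size_lam r u \<tau> h) (X \<circ> Hilbert_Choice.inv \<pi>) j =
    (block_move r lam' h X \<circ> Hilbert_Choice.inv \<pi>) j"
    using block_proj_conj_map[OF assms, of "Hilbert_Choice.inv \<pi> j"] out permutes_inverses[OF perm_pi]
    by (auto simp: block_move_def shift_map_def split: prod.splits)
qed

text \<open>Here the twist meets the exponents: the factor at \<open>\<pi> k\<close> acquires the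
  exponent \<open>u * \<pi> k\<close>, which is \<open>k\<close> modulo \<open>r\<close>.\<close>

lemma block_char_conj_map:
  assumes h: "h \<in> block_subgroup r (map sum_list lam')"
  shows "block_char \<zeta> r lam (conj_map size_lam r u \<tau> h) = block_char \<zeta> r lam' h"
proof -
  have "block_char \<zeta> r lam (conj_map size_lam r u \<tau> h) =
      (\<Prod>k<r. zeta_char \<zeta> (sum_list (lam ! \<pi> k))
        (block_proj (map sum_list lam) (conj_map size_lam r u \<tau> h) (\<pi> k)) ^ \<pi> k)"
    unfolding block_char_def
    by (rule prod.reindex_bij_betw[symmetric]) (rule permutes_imp_bij[OF perm_pi])
  also have "\<dots> = block_char \<zeta> r lam' h"
    unfolding block_char_def
  proof (rule prod.cong[OF refl])
    fix k assume "k \<in> {..<r}"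
    then have k: "k < r" by simp
    let ?z = "zeta_char \<zeta> (sum_list (lam' ! k)) (block_proj (map sum_list lam') h k)"
    have "?z ^ (u * \<pi> k) = ?z ^ k"
      using u_pi[OF k] k by (intro zeta_char_power_cong[OF zeta]) simp
    then show "zeta_char \<zeta> (sum_list (lam ! \<pi> k))
        (block_proj (map sum_list lam) (conj_map size_lam r u \<tau> h) (\<pi> k)) ^ \<pi> k = ?z ^ k"
      using zeta_char_shift_map[OF zeta r_pos] block_proj_conj_map[OF h k] nth_lam'[OF k]
      by (simp add: power_mult)
  qed
  finally show ?thesis .
qed

text \<open>The substitution permutes the factors of a pure tensor, and pure tensors span.\<close>

lemma tensor_rep_reindex:
  assumes "F \<in> rep_space (tensor_rep \<zeta> r lam)"
  shows "(\<lambda>X. F (X \<circ> Hilbert_Choice.inv \<pi>)) \<in> rep_space (tensor_rep \<zeta> r lam')"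
proof -
  let ?W = "rep_space (tensor_rep \<zeta> r lam')"
  have "rep_space (tensor_rep \<zeta> r lam) \<subseteq> {F. (\<lambda>X. F (X \<circ> Hilbert_Choice.inv \<pi>)) \<in> ?W}"
    unfolding ext_tensor_def[of r "\<lambda>k. ext_specht_rep \<zeta> k (lam ! k)"] crep.simps
  proof (rule cfun.span_minimal)
    show "cfun.subspace {F. (\<lambda>X. F (X \<circ> Hilbert_Choice.inv \<pi>)) \<in> ?W}"
      using cfun.subspace_0[OF subspace_tensor_rep[of r \<zeta> lam']]
        cfun.subspace_add[OF subspace_tensor_rep[of r \<zeta> lam']]
        cfun.subspace_scale[OF subspace_tensor_rep[of r \<zeta> lam']]
      by (simp add: cfun.subspace_def zero_fun_def plus_fun_def fscale_def)
    have "(\<lambda>X. pure_tensor r f (X \<circ> Hilbert_Choice.inv \<pi>)) \<in> ?W"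
      if f: "\<forall>k<r. f k \<in> rep_space (ext_specht_rep \<zeta> k (lam ! k))" for f
    proof -
      have "(\<lambda>X. pure_tensor r f (X \<circ> Hilbert_Choice.inv \<pi>)) = pure_tensor r (f \<circ> \<pi>)"
      proof
        fix X
        show "pure_tensor r f (X \<circ> Hilbert_Choice.inv \<pi>) = pure_tensor r (f \<circ> \<pi>) X"
          using prod.reindex_bij_betw[OF permutes_imp_bij[OF perm_pi],
              of "\<lambda>j. f j (X (Hilbert_Choice.inv \<pi> j))"] permutes_inverses[OF perm_pi]
          by (simp add: pure_tensor_def)
      qed
      \<comment> \<open>The exponent enters only the action, so the space of a factor depends on its
        partition alone.\<close>
      moreover have "(f \<circ> \<pi>) k \<in> rep_space (ext_specht_rep \<zeta> k (lam' ! k))" if "k < r" for k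
        using f pi_less[OF that] nth_lam'[OF that] by (simp add: ext_specht_rep_def)
      ultimately show ?thesis
        by (auto simp: ext_tensor_def intro!: cfun.span_base)
    qed
    then show "{pure_tensor r f |f. \<forall>k<r. f k \<in> rep_space (ext_specht_rep \<zeta> k (lam ! k))} \<subseteq>
        {F. (\<lambda>X. F (X \<circ> Hilbert_Choice.inv \<pi>)) \<in> ?W}" by auto
  qed
  then show ?thesis using assms by auto
qed

text \<open>The automorphism alone would not do: the two representations are induced from different
  block subgroups, and the translation by \<open>(0, \<tau>)\<close> inside \<open>shift_map\<close>
  matches these up.\<close>

definition intertwiner ::
  "(gelem \<times> (nat \<Rightarrow> nat \<Rightarrow> nat) \<Rightarrow> complex) \<Rightarrow> gelem \<times> (nat \<Rightarrow> nat \<Rightarrow> nat) \<Rightarrow> complex" where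
  "intertwiner F = (\<lambda>(g, X).
    if g \<in> carrier G then F (shift_map size_lam r u \<tau> g, X \<circ> Hilbert_Choice.inv \<pi>) else 0)"

lemma clinear_intertwiner: "clinear_map intertwiner"
  by (rule clinear_mapI) (auto simp: intertwiner_def fscale_def fun_eq_iff)

text \<open>\<open>shift_map_mult_left\<close> replaces \<open>h\<close> by its conjugate in the
  block subgroup of \<open>lam\<close>, which has the same scalar and the relabelled
  substitution.\<close>

lemma intertwiner_closed: "intertwiner ` rep_space (irrep \<zeta> r lam) \<subseteq> rep_space (irrep \<zeta> r lam')"
proof clarify
  fix F assume F: "F \<in> rep_space (irrep \<zeta> r lam)"
  have "intertwiner F (h \<otimes>\<^bsub>G\<^esub> g, X) = block_char \<zeta> r lam' h * intertwiner F (g, block_move r lam' h X)"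
    if h: "h \<in> block_subgroup r (map sum_list lam')" and g: "g \<in> carrier G" for h g X
  proof -
    have hG: "h \<in> carrier G" using block_subgroup_carrier[OF h] by (simp add: sum_lam')
    then have "intertwiner F (h \<otimes>\<^bsub>G\<^esub> g, X) =
        F (conj_map size_lam r u \<tau> h \<otimes>\<^bsub>G\<^esub> shift_map size_lam r u \<tau> g, X \<circ> Hilbert_Choice.inv \<pi>)"
      using g r_pos perm_tau by (simp add: intertwiner_def gen_sym_group_mult_closed shift_map_mult_left)
    also have "\<dots> = block_char \<zeta> r lam' h *
        F (shift_map size_lam r u \<tau> g, block_move r lam' h X \<circ> Hilbert_Choice.inv \<pi>)"
      using F conj_map_block_subgroup[OF h] shift_map_closed[OF r_pos perm_tau g]
      by (simp add: irrep_space block_char_conj_map[OF h] block_move_conj_map[OF h])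
    finally show ?thesis using g by (simp add: intertwiner_def)
  qed
  moreover have "(\<lambda>X. intertwiner F (g, X)) \<in> rep_space (tensor_rep \<zeta> r lam')" if g: "g \<in> carrier G" for g
    using tensor_rep_reindex[of "\<lambda>y. F (shift_map size_lam r u \<tau> g, y)"] F g
      shift_map_closed[OF r_pos perm_tau g]
    by (simp add: irrep_space intertwiner_def)
  ultimately show "intertwiner F \<in> rep_space (irrep \<zeta> r lam')"
    by (simp add: irrep_space sum_lam') (simp add: intertwiner_def)
qed

lemma intertwiner_commutes:
  assumes g: "g \<in> carrier G"
  shows "intertwiner (rep_act (irrep \<zeta> r lam) (shift_map size_lam r u id g) F) =
    rep_act (irrep \<zeta> r lam') g (intertwiner F)"
  using g r_pos perm_tau
  by (auto simp: fun_eq_iff intertwiner_def irrep_act sum_lam' shift_map_closed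
      gen_sym_group_mult_closed shift_map_mult_right)

end

text \<open>The reversed data invert both \<open>shift_map\<close> and the relabelling of the
  variables; outside the carrier both sides vanish.\<close>

lemma (in reindexing) intertwiner_inverse:
  assumes F: "F \<in> rep_space (irrep \<zeta> r lam)"
  shows "reindexing.intertwiner r v (Hilbert_Choice.inv \<pi>) (Hilbert_Choice.inv \<tau>) lam' (intertwiner F) = F"
proof
  interpret inv: reindexing \<zeta> r v u "Hilbert_Choice.inv \<pi>" "Hilbert_Choice.inv \<tau>" lam' lam
    by (rule reindexing_inverse)
  fix p :: "gelem \<times> (nat \<Rightarrow> nat \<Rightarrow> nat)"
  obtain g X where p: "p = (g, X)" by (cases p)
  show "inv.intertwiner (intertwiner F) p = F p"
  proof (cases "g \<in> carrier G")
    case True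
    have "shift_map size_lam r u \<tau> (shift_map size_lam r v (Hilbert_Choice.inv \<tau>) g) = g"
      using shift_map_inverse[OF r_pos inv.perm_tau _ ] True inv.uv permutes_inv_inv[OF perm_tau]
      by (simp add: sum_lam')
    moreover have "X \<circ> Hilbert_Choice.inv (Hilbert_Choice.inv \<pi>) \<circ> Hilbert_Choice.inv \<pi> = X"
      using permutes_inverses[OF perm_pi] permutes_inv_inv[OF perm_pi] by (simp add: fun_eq_iff)
    ultimately show ?thesis
      using True shift_map_closed[OF r_pos inv.perm_tau, of g v]
      by (simp add: p inv.intertwiner_def intertwiner_def sum_lam')
  next
    case False
    then show ?thesis using F by (cases g) (simp add: p inv.intertwiner_def sum_lam' irrep_space)
  qed
qed

text \<open>\<open>intertwiner\<close> is an isomorphism from the twist of the representation of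
  \<open>lam\<close> to that of \<open>lam'\<close>, so \<open>op_det_conjugate\<close>
  applies.\<close>

theorem (in reindexing) rep_det_reindex:
  assumes g: "g \<in> carrier G"
  shows "rep_det (irrep \<zeta> r lam') g = rep_det (irrep \<zeta> r lam) (shift_map size_lam r u id g)"
proof -
  interpret inv: reindexing \<zeta> r v u "Hilbert_Choice.inv \<pi>" "Hilbert_Choice.inv \<tau>" lam' lam
    by (rule reindexing_inverse)
  have "intertwiner (inv.intertwiner F) = F" if "F \<in> rep_space (irrep \<zeta> r lam')" for F
    using inv.intertwiner_inverse[OF that] permutes_inv_inv[OF perm_pi] permutes_inv_inv[OF perm_tau]
    by simp
  then have "op_det (rep_space (irrep \<zeta> r lam)) (rep_act (irrep \<zeta> r lam) (shift_map size_lam r u id g)) =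
      op_det (rep_space (irrep \<zeta> r lam')) (rep_act (irrep \<zeta> r lam') g)"
    using g r_pos irrep_ordered_basis intertwiner_closed clinear_intertwiner inv.intertwiner_closed
      inv.clinear_intertwiner intertwiner_inverse irrep_act_closed clinear_irrep_act intertwiner_commutes
    by (intro op_det_conjugate[where f = intertwiner and g = inv.intertwiner])
      (auto simp: sum_lam' shift_map_closed permutes_id)
  then show ?thesis by (simp add: rep_det_def)
qed

section \<open>Permuting the components of a multipartition\<close>

lemma block_start_mono: "k \<le> l \<Longrightarrow> block_start a k \<le> block_start a l"
  using take_add[of k "l - k" a] by (simp add: block_start_def)

text \<open>Injective because a block ends before the next one starts; surjective by
  counting.\<close>

lemma block_index_bij:
  "bij_betw (\<lambda>(k, i). block_start a k + i) (Sigma {..<length a} (\<lambda>k. {1..a ! k})) {1..sum_list a}"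
proof -
  let ?A = "Sigma {..<length a} (\<lambda>k. {1..a ! k})" and ?e = "\<lambda>(k, i). block_start a k + i"
  have less: "block_start a k + i < block_start a l + j"
    if "k < l" "k < length a" "i \<in> {1..a ! k}" "j \<in> {1..a ! l}" for k l i j
  proof -
    have "block_start a k + i \<le> block_start a (Suc k)"
      using that by (simp add: block_start_Suc)
    also have "\<dots> \<le> block_start a l" using that by (simp add: block_start_mono)
    finally show ?thesis using that by simp
  qed
  have inj: "inj_on ?e ?A"
  proof (rule inj_onI, clarify)
    fix k i l j
    assume "k < length a" "i \<in> {1..a ! k}" "l < length a" "j \<in> {1..a ! l}"
      and eq: "block_start a k + i = block_start a l + j"
    then show "k = l \<and> i = j"
      using less[of k l i j] less[of l k j i] by (cases k l rule: linorder_cases) auto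
  qed
  have "?e ` ?A \<subseteq> {1..sum_list a}"
    using block_start_add_mem[of _ a] by fastforce
  moreover have "card (?e ` ?A) = card {1..sum_list a}"
    using inj by (simp add: card_image sum_list_sum_nth atLeast0LessThan)
  ultimately have "?e ` ?A = {1..sum_list a}"
    by (intro card_subset_eq) auto
  with inj show ?thesis by (simp add: bij_betw_def)
qed

text \<open>Supplies the \<open>\<tau>\<close> of \<open>reindexing\<close>: read a position as
  block and offset for \<open>b\<close>, move the block by \<open>\<pi>\<close>, and turn the pair
  into a position for \<open>a\<close>.\<close>

lemma block_permutation_exists:
  assumes pi: "\<pi> permutes {..<length a}" and len: "length b = length a"
    and nth: "\<And>k. k < length a \<Longrightarrow> b ! k = a ! \<pi> k" and sum: "sum_list b = sum_list a"
  obtains \<tau> where "\<tau> permutes {1..sum_list a}"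
    "\<And>k i. k < length a \<Longrightarrow> i \<in> {1..b ! k} \<Longrightarrow> \<tau> (block_start b k + i) = block_start a (\<pi> k) + i"
proof -
  let ?A = "Sigma {..<length a} (\<lambda>k. {1..a ! k})" and ?e = "\<lambda>(k, i). block_start a k + i"
  let ?B = "Sigma {..<length a} (\<lambda>k. {1..b ! k})" and ?f = "\<lambda>(k, i). block_start b k + i"
  let ?p = "\<lambda>(k, i :: nat). (\<pi> k, i)"
  define \<tau> where "\<tau> x = (if x \<in> {1..sum_list a} then ?e (?p (inv_into ?B ?f x)) else x)" for x
  have f: "bij_betw ?f ?B {1..sum_list a}"
    using block_index_bij[of b] len sum by simp
  have in_pi: "\<pi> k < length a \<longleftrightarrow> k < length a" "Hilbert_Choice.inv \<pi> k < length a \<longleftrightarrow> k < length a" for k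
    using permutes_in_image[OF pi, of k] permutes_in_image[OF permutes_inv[OF pi], of k] by auto
  \<comment> \<open>By \<open>nth\<close>, block \<open>k\<close> of \<open>b\<close> is as long as
    block \<open>\<pi> k\<close> of \<open>a\<close>, so offsets stay valid.\<close>
  have "bij_betw ?p ?B ?A"
    by (rule bij_betw_byWitness[where f' = "\<lambda>(k, i). (Hilbert_Choice.inv \<pi> k, i)"])
      (use permutes_inverses[OF pi] in_pi nth in auto)
  then have "bij_betw (?e \<circ> (?p \<circ> inv_into ?B ?f)) {1..sum_list a} {1..sum_list a}"
    using block_index_bij[of a] bij_betw_inv_into[OF f] by (blast intro: bij_betw_trans)
  then have "bij_betw \<tau> {1..sum_list a} {1..sum_list a}"
    by (subst bij_betw_cong[of _ _ "?e \<circ> (?p \<circ> inv_into ?B ?f)"]) (auto simp: \<tau>_def)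
  then have "\<tau> permutes {1..sum_list a}"
    by (rule bij_imp_permutes) (auto simp: \<tau>_def)
  moreover have "\<tau> (block_start b k + i) = block_start a (\<pi> k) + i"
    if "k < length a" "i \<in> {1..b ! k}" for k i
  proof -
    have "(k, i) \<in> ?B" using that by auto
    then have "inv_into ?B ?f (?f (k, i)) = (k, i)"
      by (rule bij_betw_inv_into_left[OF f])
    moreover have "block_start b k + i \<in> {1..sum_list a}"
      using block_start_add_mem[of k b i] that len sum by simp
    ultimately show ?thesis by (simp add: \<tau>_def)
  qed
  ultimately show ?thesis by (rule that)
qed

section \<open>Multiplication of the indices by a unit\<close>

definition mult_perm :: "nat \<Rightarrow> nat \<Rightarrow> nat \<Rightarrow> nat" where
  "mult_perm r v k = (if k < r then v * k mod r else k)"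

lemma mult_perm_less: "k < r \<Longrightarrow> mult_perm r v k < r"
  by (auto simp: mult_perm_def)

lemma mult_perm_inverse:
  assumes "u * v mod r = 1 mod r"
  shows "mult_perm r u (mult_perm r v k) = k"
proof (cases "k < r")
  case True
  have "u * (v * k mod r) mod r = (u * v) * k mod r" by (simp add: mod_mult_right_eq mult.assoc)
  also have "\<dots> = k" using True assms by (metis mod_less mod_mult_left_eq mult_1)
  finally show ?thesis using True by (simp add: mult_perm_def)
qed (simp add: mult_perm_def)

text \<open>Multiplication by \<open>u\<close> is the inverse map; the default value
  \<open>k\<close> from \<open>r\<close> on is what \<open>permutes\<close> demands.\<close>

lemma mult_perm_permutes:
  assumes "u * v mod r = 1 mod r"
  shows "mult_perm r v permutes {..<r}"
proof (rule bij_imp_permutes)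
  have "v * u mod r = 1 mod r" using assms by (simp add: mult.commute)
  then show "bij_betw (mult_perm r v) {..<r} {..<r}"
    using mult_perm_inverse[OF assms] mult_perm_inverse[of v u r]
    by (intro bij_betw_byWitness[where f' = "mult_perm r u"]) (auto simp: mult_perm_less)
qed (simp add: mult_perm_def)

text \<open>For a twist by \<open>u\<close> the multiplier is its inverse \<open>v\<close>: position
  \<open>k\<close> receives the component whose exponent the twist turns into
  \<open>k\<close>.\<close>

definition permute_components :: "nat \<Rightarrow> nat \<Rightarrow> nat list list \<Rightarrow> nat list list" where
  "permute_components r v lam = map (\<lambda>k. lam ! mult_perm r v k) [0..<r]"

lemma sum_list_permute_components:
  assumes "u * v mod r = 1 mod r" "length lam = r"
  shows "(\<Sum>\<mu>\<leftarrow>permute_components r v lam. sum_list \<mu>) = (\<Sum>\<mu>\<leftarrow>lam. sum_list \<mu>)"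
proof -
  have "(\<Sum>\<mu>\<leftarrow>permute_components r v lam. sum_list \<mu>) = (\<Sum>k<r. sum_list (lam ! mult_perm r v k))"
    by (simp add: permute_components_def sum_list_sum_nth atLeast0LessThan)
  also have "\<dots> = (\<Sum>k<r. sum_list (lam ! k))"
    by (rule sum.reindex_bij_betw) (rule permutes_imp_bij[OF mult_perm_permutes[OF assms(1)]])
  finally show ?thesis
    using assms(2) by (simp add: sum_list_sum_nth atLeast0LessThan)
qed

lemma permute_components_multipartition:
  assumes "u * v mod r = 1 mod r" "lam \<in> multipartitions n r"
  shows "permute_components r v lam \<in> multipartitions n r"
proof -
  have "set (permute_components r v lam) \<subseteq> set lam"
    using assms(2) by (auto simp: permute_components_def multipartitions_def mult_perm_less)
  then show ?thesis
    using assms sum_list_permute_components[OF assms(1), of lam]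
    by (auto simp: multipartitions_def permute_components_def)
qed

lemma permute_components_inverse:
  assumes "v * u mod r = 1 mod r" "length lam = r"
  shows "permute_components r u (permute_components r v lam) = lam"
proof (rule nth_equalityI)
  fix k assume "k < length (permute_components r u (permute_components r v lam))"
  then have "k < r" by (simp add: permute_components_def)
  then show "permute_components r u (permute_components r v lam) ! k = lam ! k"
    using mult_perm_inverse[OF assms(1)] by (simp add: permute_components_def mult_perm_less)
qed (use assms in \<open>simp add: permute_components_def\<close>)

lemma rep_det_permute_components:
  assumes r: "r > 0" and zeta: "\<zeta> ^ r = 1" and uv: "u * v mod r = 1 mod r"
    and lam: "lam \<in> multipartitions n r" and g: "g \<in> carrier (gen_sym_group n r)"
  shows "rep_det (irrep \<zeta> r (permute_components r v lam)) g =
    rep_det (irrep \<zeta> r lam) (shift_map n r u id g)"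
proof -
  let ?lam = "permute_components r v lam"
  have len: "length lam = r" "length ?lam = r" and n: "sum_list (map sum_list lam) = n"
    using lam by (auto simp: multipartitions_def permute_components_def)
  have nth: "?lam ! k = lam ! mult_perm r v k" if "k < r" for k
    using that by (simp add: permute_components_def)
  have sum: "sum_list (map sum_list ?lam) = sum_list (map sum_list lam)"
    by (rule sum_list_permute_components[OF uv len(1)])
  have perm: "mult_perm r v permutes {..<length (map sum_list lam)}"
    using mult_perm_permutes[OF uv] len by simp
  have nth_sizes: "map sum_list ?lam ! k = map sum_list lam ! mult_perm r v k"
    if "k < length (map sum_list lam)" for k
    using that len nth mult_perm_less by simp
  obtain \<tau> where tau: "\<tau> permutes {1..sum_list (map sum_list lam)}"
    "\<And>k i. k < length (map sum_list lam) \<Longrightarrow> i \<in> {1..map sum_list ?lam ! k} \<Longrightarrow>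
      \<tau> (block_start (map sum_list ?lam) k + i) = block_start (map sum_list lam) (mult_perm r v k) + i"
    by (rule block_permutation_exists[OF perm _ nth_sizes sum]) (simp_all only: length_map len)
  interpret reindexing \<zeta> r u v "mult_perm r v" \<tau> lam ?lam
  proof
    show "u * mult_perm r v k mod r = k" if "k < r" for k
      using mult_perm_inverse[OF uv, of k] that mult_perm_less[OF that, of v]
      by (simp add: mult_perm_def[of r u])
    show "\<tau> (block_start (map sum_list ?lam) k + i) =
        block_start (map sum_list lam) (mult_perm r v k) + i"
      if "k < r" "i \<in> {1..sum_list (?lam ! k)}" for k i
      using tau(2)[of k i] that len by simp
  qed (fact r zeta uv mult_perm_permutes[OF uv] len nth sum tau(1))+
  show ?thesis using rep_det_reindex g n by simp
qed

text \<open>The twist replaces \<open>s\<close> by \<open>u * s\<close>. The factor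
  \<open>\<chi>\<close>, fixed by the automorphism, lets one argument serve for the trivial
  character and for \<open>sgn_char\<close>.\<close>

lemma permute_components_det_char:
  assumes r: "r > 0" and zeta: "\<zeta> ^ r = 1" and uv: "u * v mod r = 1 mod r"
    and us: "u * s mod r = t mod r" and chi: "\<And>g. \<chi> (shift_map n r u id g) = \<chi> g"
    and lam: "lam \<in> multipartitions n r"
    and det: "\<forall>g\<in>carrier (gen_sym_group n r). rep_det (irrep \<zeta> r lam) g = zeta_char \<zeta> n g ^ s * \<chi> g"
  shows "\<forall>g\<in>carrier (gen_sym_group n r).
    rep_det (irrep \<zeta> r (permute_components r v lam)) g = zeta_char \<zeta> n g ^ t * \<chi> g"
proof
  fix g assume g: "g \<in> carrier (gen_sym_group n r)"
  have "rep_det (irrep \<zeta> r (permute_components r v lam)) g = (zeta_char \<zeta> n g ^ u) ^ s * \<chi> g"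
    using rep_det_permute_components[OF r zeta uv lam g] det
      shift_map_closed[OF r permutes_id g, of u]
    by (simp add: chi zeta_char_shift_map[OF zeta r])
  also have "(zeta_char \<zeta> n g ^ u) ^ s = zeta_char \<zeta> n g ^ t"
    using zeta_char_power_cong[OF zeta us] by (simp add: power_mult)
  finally show "rep_det (irrep \<zeta> r (permute_components r v lam)) g = zeta_char \<zeta> n g ^ t * \<chi> g" .
qed

text \<open>Since \<open>r\<close> is prime, some unit \<open>u\<close> takes \<open>s\<close> to
  \<open>t\<close>, and permuting components is a bijection undone by the inverse unit.\<close>

lemma card_det_char_eq:
  assumes r: "prime r" and zeta: "\<zeta> ^ r = 1" and s: "s \<in> {1..<r}" and t: "t \<in> {1..<r}"
    and chi: "\<And>u g. \<chi> (shift_map n r u id g) = \<chi> g"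
  shows "card {lam \<in> multipartitions n r. \<forall>g\<in>carrier (gen_sym_group n r).
      rep_det (irrep \<zeta> r lam) g = zeta_char \<zeta> n g ^ s * \<chi> g} =
    card {lam \<in> multipartitions n r. \<forall>g\<in>carrier (gen_sym_group n r).
      rep_det (irrep \<zeta> r lam) g = zeta_char \<zeta> n g ^ t * \<chi> g}"
    (is "card ?A = card ?B")
proof -
  have inverse: "\<exists>x. c * x mod r = 1 mod r" if "c \<in> {1..<r}" for c
  proof -
    have "\<not> r dvd c" using that by (intro nat_dvd_not_less) auto
    then have "coprime c r" using prime_imp_coprime[OF r] by (simp add: coprime_commute)
    then show ?thesis using cong_solve_coprime_nat[of c r] by (simp add: cong_def)
  qed
  obtain x y where x: "s * x mod r = 1 mod r" and y: "t * y mod r = 1 mod r"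
    using inverse[OF s] inverse[OF t] by auto
  \<comment> \<open>Modulo \<open>r\<close>, \<open>u\<close> is \<open>t / s\<close> and
    \<open>v\<close> is \<open>s / t\<close>.\<close>
  define u v where "u = t * x" and "v = s * y"
  have uv: "u * v mod r = 1 mod r"
  proof -
    have "u * v mod r = (s * x mod r) * (t * y mod r) mod r"
      by (simp add: u_def v_def mod_mult_eq mult_ac)
    then show ?thesis by (simp add: x y mod_mult_eq)
  qed
  then have vu: "v * u mod r = 1 mod r" by (simp add: mult.commute)
  have us: "u * s mod r = t mod r" and vt: "v * t mod r = s mod r"
  proof -
    have "u * s mod r = t * (s * x mod r) mod r" by (simp add: u_def mod_mult_right_eq mult_ac)
    then show "u * s mod r = t mod r" by (simp only: x mod_mult_right_eq mult_1_right)
    have "v * t mod r = s * (t * y mod r) mod r" by (simp add: v_def mod_mult_right_eq mult_ac)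
    then show "v * t mod r = s mod r" by (simp only: y mod_mult_right_eq mult_1_right)
  qed
  have r0: "r > 0" using r by (simp add: prime_gt_0_nat)
  have "bij_betw (permute_components r v) ?A ?B"
  proof (rule bij_betw_byWitness[where f' = "permute_components r u"])
    show "\<forall>lam\<in>?A. permute_components r u (permute_components r v lam) = lam"
      "\<forall>lam\<in>?B. permute_components r v (permute_components r u lam) = lam"
      using permute_components_inverse[OF vu] permute_components_inverse[OF uv]
      by (auto simp: multipartitions_def)
    show "permute_components r v ` ?A \<subseteq> ?B"
      using permute_components_multipartition[OF uv]
        permute_components_det_char[OF r0 zeta uv us, where \<chi> = \<chi>, OF chi] by blast
    show "permute_components r u ` ?B \<subseteq> ?A"
      using permute_components_multipartition[OF vu]
        permute_components_det_char[OF r0 zeta vu vt, where \<chi> = \<chi>, OF chi] by blast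
  qed
  then show ?thesis by (rule bij_betw_same_card)
qed

theorem theorem7:
  fixes r n :: nat and \<zeta> :: complex
  assumes "prime r" and "odd r" and "n \<ge> 1"
    and "primitive_root_of_unity r \<zeta>"
  shows "(\<forall>s\<in>{1..<r}. \<forall>t\<in>{1..<r}. N_plus \<zeta> r s n = N_plus \<zeta> r t n) \<and>
         (\<forall>s\<in>{1..<r}. \<forall>t\<in>{1..<r}. N_minus \<zeta> r s n = N_minus \<zeta> r t n)"
proof -
  have r: "prime r" and zeta: "\<zeta> ^ r = 1"
    using assms by (auto simp: primitive_root_of_unity_def)
  show ?thesis
  proof (intro conjI ballI)
    fix s t assume st: "s \<in> {1..<r}" "t \<in> {1..<r}"
    show "N_plus \<zeta> r s n = N_plus \<zeta> r t n"
      using card_det_char_eq[OF r zeta st, where \<chi> = "\<lambda>_. 1"] by (simp add: N_plus_def)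
    \<comment> \<open>For \<open>n = 1\<close> both sides are 0 by definition.\<close>
    show "N_minus \<zeta> r s n = N_minus \<zeta> r t n"
      using card_det_char_eq[OF r zeta st, where \<chi> = sgn_char, OF sgn_char_shift_map]
      by (simp add: N_minus_def)
  qed
qed

end
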